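(* Let $X$ be a real Hilbert space and let $f\colon X\to\mathbb{R}$ be convex and continuous with $C=\{x\in X : f(x)\le 0\}\neq\varnothing$. Suppose that $f$ is Gâteaux differentiable on $X\setminus C$ and that the subgradient projector $G_f$ is firmly nonexpansive. Then $G_g$ is firmly nonexpansive in each of the following situations: (i) $\alpha>0$, and $g=f\circ\alpha\,\mathrm{Id}$ is convex. (ii) $f\ge0$, $\alpha\ge1$, and $g=f^\alpha$ is convex. (iii) $A\colon X\to X$ is continuous and linear, $AA^*=A^*A=\mathrm{Id}$, and $g=f\circ A$. (iv) $z\in X$ and $g\colon x\mapsto f(x-z)$. The analogous statement holds for nonexpansiveness: if $G_f$ is nonexpansive, then $G_g$ is nonexpansive in each of the situations (i)–(iv).
   Context: For a convex continuous $h\colon X\to\mathbb{R}$ with $\{h\le0\}\ne\varnothing$ and a selection $s$ of the convex subdifferential $\partial h$, the subgradient projector is $G_h(x)=x-\frac{h(x)}{\|s(x)\|^2}s(x)$ if $h(x)>0$, and $G_h(x)=x$ otherwise; it does not depend on $s$ if $h$ is Gâteaux differentiable on $\{h>0\}$ (then $s(x)=\nabla h(x)$ there). A map $T\colon X\to X$ is nonexpansive if $\|Tx-Ty\|\le\|x-y\|$ for all $x,y$, and firmly nonexpansive if $\|Tx-Ty\|^2\le\langle x-y,Tx-Ty\rangle$ for all $x,y$. *)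

theory Defs
  imports "HOL-Analysis.Analysis"
begin

definition subdifferential :: "('a::real_inner \<Rightarrow> real) \<Rightarrow> 'a \<Rightarrow> 'a set" where
  "subdifferential h x = {u. \<forall>y. h x + inner u (y - x) \<le> h y}"

definition subgradient_selection :: "('a::real_inner \<Rightarrow> real) \<Rightarrow> ('a \<Rightarrow> 'a) \<Rightarrow> bool" where
  "subgradient_selection h s \<longleftrightarrow> (\<forall>x. s x \<in> subdifferential h x)"

text \<open>The subgradient projector is taken with respect to an explicit selection \<open>s\<close> of the
  subdifferential. If \<open>{x. h x \<le> 0}\<close> is nonempty, then \<open>s x \<noteq> 0\<close> whenever \<open>h x > 0\<close>,
  so the division below is a genuine one. If \<open>h\<close> is Gateaux differentiable on
  \<open>{x. h x > 0}\<close>, the result does not depend on \<open>s\<close>.\<close>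

definition subgradient_projector :: "('a::real_inner \<Rightarrow> real) \<Rightarrow> ('a \<Rightarrow> 'a) \<Rightarrow> 'a \<Rightarrow> 'a" where
  "subgradient_projector h s x =
     (if h x > 0 then x - (h x / (norm (s x))\<^sup>2) *\<^sub>R s x else x)"

definition gateaux_differentiable_at :: "('a::real_normed_vector \<Rightarrow> real) \<Rightarrow> 'a \<Rightarrow> bool" where
  "gateaux_differentiable_at h x \<longleftrightarrow>
     (\<exists>D. bounded_linear D \<and>
          (\<forall>v. ((\<lambda>t::real. (h (x + t *\<^sub>R v) - h x) / t) \<longlongrightarrow> D v) (at 0)))"

definition nonexpansive :: "('a::real_normed_vector \<Rightarrow> 'a) \<Rightarrow> bool" where
  "nonexpansive T \<longleftrightarrow> (\<forall>x y. norm (T x - T y) \<le> norm (x - y))"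

definition firmly_nonexpansive :: "('a::real_inner \<Rightarrow> 'a) \<Rightarrow> bool" where
  "firmly_nonexpansive T \<longleftrightarrow>
     (\<forall>x y. (norm (T x - T y))\<^sup>2 \<le> inner (x - y) (T x - T y))"

end

theory Submission
  imports Defs
begin

text \<open>Situations (i), (iii) and (iv) are all of the form \<open>g = f \<circ> P\<close> with \<open>P\<close> a surjective similarity
  with linear part \<open>L\<close> and squared ratio \<open>c\<close>. Then \<open>L\<close> maps subgradients of \<open>g\<close> at \<open>x\<close> to \<open>c\<close> times
  subgradients of \<open>f\<close> at \<open>P x\<close>, and the latter are unique where \<open>f > 0\<close>; hence
  \<open>P \<circ> G\<^sub>g = G\<^sub>f \<circ> P\<close>, and (firm) nonexpansiveness passes from \<open>G\<^sub>f\<close> to \<open>G\<^sub>g\<close>.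
  In situation (ii) the chain rule gives \<open>G\<^sub>g = (1 - 1/\<alpha>) Id + (1/\<alpha>) G\<^sub>f\<close>.\<close>

section \<open>Riesz representation and the Hilbert space adjoint\<close>

text \<open>The representing vector is found as a minimiser of a quadratic functional: completeness
  provides the minimiser, and the first-order condition along each line through it is the
  representation. The result is used for the existence of adjoints.\<close>

lemma Riesz_representation:
  fixes \<phi> :: "'a::{real_inner, complete_space} \<Rightarrow> real"
  assumes "bounded_linear \<phi>"
  obtains z where "\<And>v. \<phi> v = inner z v"
proof -
  interpret \<phi>: bounded_linear \<phi> by fact
  \<comment> \<open>If \<open>\<phi>\<close> is \<open>inner z\<close>, then \<open>J x\<close> is
    the squared distance from \<open>x\<close> to \<open>z\<close> minus the squared norm of
    \<open>z\<close>, so its minimiser has to be \<open>z\<close>.\<close>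
  define J where "J x = (norm x)\<^sup>2 - 2 * \<phi> x" for x
  have J_inner: "J x = inner x x - 2 * \<phi> x" for x
    by (simp add: J_def power2_norm_eq_inner)
  obtain K where K: "\<And>x. norm (\<phi> x) \<le> norm x * K"
    using \<phi>.bounded by blast
  have J_lower: "- K\<^sup>2 \<le> J x" for x
  proof -
    have "\<phi> x \<le> norm x * K"
      using K[of x] by simp
    moreover have "0 \<le> (norm x - K)\<^sup>2"
      by simp
    ultimately show ?thesis
      by (simp add: J_def power2_diff algebra_simps)
  qed
  have bdd: "bdd_below (range J)"
    using J_lower by (intro bdd_belowI[of _ "- K\<^sup>2"]) auto
  define m where "m = Inf (range J)"
  have m_le: "m \<le> J x" for x
    unfolding m_def using bdd by (intro cInf_lower) auto
  have "\<exists>x. J x < m + inverse (real (Suc n))" for n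
  proof -
    have "Inf (range J) < m + inverse (real (Suc n))"
      by (simp add: m_def)
    then show ?thesis
      using cInf_lessD[of "range J"] by blast
  qed
  then obtain X where X: "\<And>n. J (X n) < m + inverse (real (Suc n))"
    by metis
  \<comment> \<open>The parallelogram law, in which the linear terms of \<open>J\<close> cancel,
    with the value of \<open>J\<close> at the midpoint bounded below by \<open>m\<close>.\<close>
  have parallelogram: "(norm (x - y))\<^sup>2 \<le> 2 * J x + 2 * J y - 4 * m" for x y
  proof -
    have "(norm (x - y))\<^sup>2 = 2 * J x + 2 * J y - 4 * J ((1/2) *\<^sub>R (x + y))"
      by (simp add: J_inner \<phi>.scaleR \<phi>.add power2_norm_eq_inner inner_simps inner_commute
          field_simps del: norm_scaleR)
    then show ?thesis
      using m_le[of "(1/2) *\<^sub>R (x + y)"] by simp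
  qed
  have "Cauchy X"
  proof (rule CauchyI)
    fix e :: real
    assume "0 < e"
    \<comment> \<open>Each of the two values of \<open>J\<close> exceeds \<open>m\<close> by less
      than a quarter of the square of \<open>e\<close>, and \<open>parallelogram\<close> counts each
      excess twice.\<close>
    then obtain N where N: "inverse (real (Suc N)) < e\<^sup>2 / 4"
      using reals_Archimedean[of "e\<^sup>2 / 4"] by auto
    have "norm (X i - X j) < e" if "N \<le> i" "N \<le> j" for i j
    proof -
      have "inverse (real (Suc i)) \<le> inverse (real (Suc N))"
        "inverse (real (Suc j)) \<le> inverse (real (Suc N))"
        using that by (auto intro: le_imp_inverse_le)
      then have "(norm (X i - X j))\<^sup>2 < e\<^sup>2"
        using parallelogram[of "X i" "X j"] X[of i] X[of j] N by linarith
      then show ?thesis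
        using \<open>0 < e\<close> by (simp add: power2_less_imp_less)
    qed
    then show "\<exists>M. \<forall>i\<ge>M. \<forall>j\<ge>M. norm (X i - X j) < e"
      by blast
  qed
  then obtain z where z: "X \<longlonglongrightarrow> z"
    using Cauchy_convergent convergent_def by blast
  have "(\<lambda>n. J (X n)) \<longlonglongrightarrow> J z"
    unfolding J_def by (intro tendsto_intros z \<phi>.tendsto)
  moreover have "(\<lambda>n. m + inverse (real (Suc n))) \<longlonglongrightarrow> m + 0"
    by (intro tendsto_intros LIMSEQ_inverse_real_of_nat)
  ultimately have "J z \<le> m + 0"
    by (rule LIMSEQ_le) (use X less_imp_le in blast)
  then have z_min: "J z \<le> J x" for x
    using m_le[of x] by simp
  have "\<phi> v = inner z v" for v
  proof -
    \<comment> \<open>Along a line \<open>J\<close> is a quadratic polynomial in \<open>r\<close>;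
      its linear coefficient is the derivative at 0, which vanishes at the minimiser.\<close>
    have J_line: "J (z + r *\<^sub>R v) = J z + (2 * inner z v - 2 * \<phi> v) * r + inner v v * r\<^sup>2" for r
      by (simp add: J_inner \<phi>.scaleR \<phi>.add inner_simps inner_commute
          power2_eq_square algebra_simps)
    have "((\<lambda>r. J (z + r *\<^sub>R v)) has_real_derivative (2 * inner z v - 2 * \<phi> v)) (at 0)"
      unfolding J_line by (auto intro!: derivative_eq_intros)
    then have "2 * inner z v - 2 * \<phi> v = 0"
      by (rule DERIV_local_min[where d = 1]) (use z_min in auto)
    then show ?thesis
      by simp
  qed
  then show thesis
    using that by blast
qed

text \<open>\<open>adjoint\<close> is defined by a choice operator, so its characteristic identity
  holds once some adjoint exists; Riesz yields its value at each \<open>y\<close>.\<close>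

lemma adjoint_works_Hilbert:
  fixes A :: "'a::{real_inner, complete_space} \<Rightarrow> 'b::real_inner"
  assumes "bounded_linear A"
  shows "inner (A x) y = inner x (adjoint A y)"
proof -
  have "\<exists>w. \<forall>x. inner (A x) y = inner x w" for y
  proof -
    have "bounded_linear (\<lambda>x. inner (A x) y)"
      using assms by (rule bounded_linear_compose[OF bounded_linear_inner_left])
    then obtain w where "\<And>v. inner (A v) y = inner w v"
      using Riesz_representation by blast
    then show ?thesis
      by (metis inner_commute)
  qed
  then have "\<exists>B. \<forall>x y. inner (A x) y = inner x (B y)"
    by metis
  then have "\<forall>x y. inner (A x) y = inner x (adjoint A y)"
    unfolding adjoint_def by (rule someI_ex)
  then show ?thesis
    by blast
qed

section \<open>Subgradients and directional derivatives\<close>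

text \<open>By the subgradient inequality, \<open>h (x + r *\<^sub>R v) - r * inner u v\<close> is
  minimal at \<open>r = 0\<close>, so its derivative there is zero.\<close>

lemma subgradient_eq_derivative:
  assumes "u \<in> subdifferential h x"
    and "((\<lambda>r. h (x + r *\<^sub>R v)) has_real_derivative d) (at 0)"
  shows "inner u v = d"
proof -
  have "((\<lambda>r. h (x + r *\<^sub>R v) - r * inner u v) has_real_derivative (d - inner u v)) (at 0)"
    by (auto intro!: derivative_eq_intros assms(2))
  then have "d - inner u v = 0"
  proof (rule DERIV_local_min[where d = 1])
    have "h x + inner u ((x + r *\<^sub>R v) - x) \<le> h (x + r *\<^sub>R v)" for r
      using assms(1) unfolding subdifferential_def by blast
    then show "\<forall>y. \<bar>0 - y\<bar> < 1 \<longrightarrow>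
        h (x + 0 *\<^sub>R v) - 0 * inner u v \<le> h (x + y *\<^sub>R v) - y * inner u v"
      by (simp add: le_diff_eq)
  qed simp
  then show ?thesis
    by simp
qed

lemma gateaux_differentiable_atE:
  assumes "gateaux_differentiable_at h x"
  obtains D where "\<And>v. ((\<lambda>r. h (x + r *\<^sub>R v)) has_real_derivative D v) (at 0)"
  using assms unfolding gateaux_differentiable_at_def DERIV_def by auto

lemma subgradient_unique:
  assumes "gateaux_differentiable_at h x"
    and "u \<in> subdifferential h x" and "w \<in> subdifferential h x"
  shows "u = w"
proof -
  obtain D where D: "\<And>v. ((\<lambda>r. h (x + r *\<^sub>R v)) has_real_derivative D v) (at 0)"
    using gateaux_differentiable_atE[OF assms(1)] by blast
  have "inner u v = inner w v" for v
    using subgradient_eq_derivative[OF assms(2) D] subgradient_eq_derivative[OF assms(3) D] by simp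
  then show ?thesis
    using vector_eq_rdot by blast
qed

section \<open>Conjugation by similarities\<close>

text \<open>Inner products of differences of \<open>P\<close>-images carry the factor
  \<open>c\<close>. Evaluating the inequality for \<open>T\<close> at \<open>P x\<close> and
  \<open>P y\<close> therefore gives \<open>c\<close> times the one for \<open>U\<close>, and
  \<open>c\<close> is positive.\<close>

lemma nonexpansive_similarity:
  fixes L P T U :: "'a::real_inner \<Rightarrow> 'a"
  assumes "0 < c"
    and P: "\<And>x y. P x - P y = L (x - y)"
    and L: "\<And>x y. inner (L x) (L y) = c * inner x y"
    and conj: "\<And>x. P (U x) = T (P x)"
  shows "firmly_nonexpansive T \<longrightarrow> firmly_nonexpansive U"
    and "nonexpansive T \<longrightarrow> nonexpansive U"
proof -
  have inner_P: "inner (P x - P y) (P u - P w) = c * inner (x - y) (u - w)" for x y u w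
    by (simp add: P L)
  have norm_P: "(norm (P x - P y))\<^sup>2 = c * (norm (x - y))\<^sup>2" for x y
    by (simp add: power2_norm_eq_inner inner_P)
  show "firmly_nonexpansive T \<longrightarrow> firmly_nonexpansive U"
  proof
    assume "firmly_nonexpansive T"
    then have "(norm (T (P x) - T (P y)))\<^sup>2 \<le> inner (P x - P y) (T (P x) - T (P y))" for x y
      unfolding firmly_nonexpansive_def by blast
    then have "c * (norm (U x - U y))\<^sup>2 \<le> c * inner (x - y) (U x - U y)" for x y
      by (metis conj inner_P norm_P)
    then show "firmly_nonexpansive U"
      using \<open>0 < c\<close> unfolding firmly_nonexpansive_def by simp
  qed
  show "nonexpansive T \<longrightarrow> nonexpansive U"
  proof
    assume "nonexpansive T"
    then have "(norm (T (P x) - T (P y)))\<^sup>2 \<le> (norm (P x - P y))\<^sup>2" for x y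
      unfolding nonexpansive_def by (simp add: power_mono)
    then have "c * (norm (U x - U y))\<^sup>2 \<le> c * (norm (x - y))\<^sup>2" for x y
      by (metis conj norm_P)
    then show "nonexpansive U"
      using \<open>0 < c\<close> unfolding nonexpansive_def by (simp add: power2_le_iff_abs_le)
  qed
qed

text \<open>Because \<open>inner (t x) (w - x)\<close> equals
  \<open>inverse c * inner (L (t x)) (P w - P x)\<close>, the vector
  \<open>inverse c *\<^sub>R L (t x)\<close> is a subgradient of \<open>f\<close> at
  \<open>P x\<close>, hence equal to \<open>s (P x)\<close> by uniqueness.\<close>

lemma subgradient_projector_similarity:
  fixes L P :: "'a::real_inner \<Rightarrow> 'a"
  assumes gateaux: "\<And>x. 0 < f x \<Longrightarrow> gateaux_differentiable_at f x"
    and s: "subgradient_selection f s" and t: "subgradient_selection (f \<circ> P) t"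
    and "0 < c"
    and "linear L" and "surj P"
    and P: "\<And>x y. P x - P y = L (x - y)"
    and L: "\<And>x y. inner (L x) (L y) = c * inner x y"
  shows "P (subgradient_projector (f \<circ> P) t x) = subgradient_projector f s (P x)"
proof (cases "0 < f (P x)")
  case True
  have "f (P x) + inner (inverse c *\<^sub>R L (t x)) (y - P x) \<le> f y" for y
  proof -
    \<comment> \<open>Surjectivity of \<open>P\<close> is what allows the inequality for
      \<open>f\<close> to be tested at every point \<open>y\<close>.\<close>
    obtain w where w: "y = P w"
      using \<open>surj P\<close> by (meson surjD)
    have "f (P x) + inner (t x) (w - x) \<le> f (P w)"
      using t by (simp add: subgradient_selection_def subdifferential_def)
    then show ?thesis
      using \<open>0 < c\<close> by (simp add: w P L mult.assoc[symmetric])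
  qed
  then have "inverse c *\<^sub>R L (t x) \<in> subdifferential f (P x)"
    by (simp add: subdifferential_def)
  moreover have "s (P x) \<in> subdifferential f (P x)"
    using s by (simp add: subgradient_selection_def)
  ultimately have s_eq: "s (P x) = inverse c *\<^sub>R L (t x)"
    using subgradient_unique[OF gateaux[OF True]] by blast
  \<comment> \<open>Two factors \<open>inverse c\<close> from \<open>s_eq\<close> meet one factor
    \<open>c\<close> from \<open>L\<close>. The remaining \<open>inverse c\<close> in the
    denominator of the step cancels the one in its direction.\<close>
  then have "(norm (s (P x)))\<^sup>2 = inverse c * (norm (t x))\<^sup>2"
    using \<open>0 < c\<close> by (simp add: power2_norm_eq_inner L del: norm_scaleR)
  moreover have "P (x - k *\<^sub>R t x) = P x - k *\<^sub>R L (t x)" for k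
    using P[of "x - k *\<^sub>R t x" x] \<open>linear L\<close>
    by (simp add: linear_neg linear_scale algebra_simps)
  ultimately show ?thesis
    using True \<open>0 < c\<close> by (simp add: subgradient_projector_def s_eq)
qed (simp add: subgradient_projector_def)

section \<open>Powers and relaxations\<close>

text \<open>Taking the power rescales the subgradient by
  \<open>k = \<alpha> * f x powr (\<alpha> - 1)\<close>. The direction of the step is unchanged, and
  its length shrinks by the factor \<open>1 / \<alpha>\<close>.\<close>

lemma subgradient_projector_powr:
  assumes gateaux: "\<And>x. 0 < f x \<Longrightarrow> gateaux_differentiable_at f x"
    and s: "subgradient_selection f s" and t: "subgradient_selection (\<lambda>x. f x powr \<alpha>) t"
    and "\<And>x. 0 \<le> f x" and "1 \<le> \<alpha>"
  shows "subgradient_projector (\<lambda>x. f x powr \<alpha>) t x =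
    (1 - 1 / \<alpha>) *\<^sub>R x + (1 / \<alpha>) *\<^sub>R subgradient_projector f s x"
proof (cases "0 < f x")
  case True
  obtain D where D: "\<And>v. ((\<lambda>r. f (x + r *\<^sub>R v)) has_real_derivative D v) (at 0)"
    using gateaux_differentiable_atE[OF gateaux[OF True]] by blast
  define k where "k = \<alpha> * f x powr (\<alpha> - 1)"
  have "0 < k"
    using True \<open>1 \<le> \<alpha>\<close> by (simp add: k_def)
  have "inner (t x) v = inner (k *\<^sub>R s x) v" for v
  proof -
    have "((\<lambda>r. f (x + r *\<^sub>R v) powr \<alpha>) has_real_derivative k * D v) (at 0)"
      using DERIV_fun_powr[OF D, of v \<alpha>] True by (simp add: k_def)
    moreover have "t x \<in> subdifferential (\<lambda>x. f x powr \<alpha>) x" "s x \<in> subdifferential f x"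
      using s t by (auto simp: subgradient_selection_def)
    ultimately show ?thesis
      using subgradient_eq_derivative[of "t x"] subgradient_eq_derivative[OF _ D] by simp
  qed
  then have t_eq: "t x = k *\<^sub>R s x"
    using vector_eq_rdot by blast
  have "f x powr \<alpha> = f x * (k / \<alpha>)"
    using True \<open>1 \<le> \<alpha>\<close> by (simp add: k_def powr_diff)
  \<comment> \<open>Should \<open>s x\<close> vanish, both sides are 0, since division by zero
    yields 0.\<close>
  then have "f x powr \<alpha> / (norm (t x))\<^sup>2 * k = 1 / \<alpha> * (f x / (norm (s x))\<^sup>2)"
    using \<open>0 < k\<close> by (simp add: t_eq power_mult_distrib power2_eq_square)
  then have "(f x powr \<alpha> / (norm (t x))\<^sup>2) *\<^sub>R t x =
      (1 / \<alpha>) *\<^sub>R ((f x / (norm (s x))\<^sup>2) *\<^sub>R s x)"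
    by (metis t_eq scaleR_scaleR)
  then show ?thesis
    using True by (simp add: subgradient_projector_def algebra_simps)
next
  case False
  \<comment> \<open>Both projectors fix such a point, because \<open>0 powr \<alpha>\<close> is 0 as
    well.\<close>
  then have "f x = 0"
    using assms(4)[of x] by simp
  then show ?thesis
    by (simp add: subgradient_projector_def algebra_simps)
qed

lemma firmly_nonexpansive_relaxation:
  fixes T :: "'a::real_inner \<Rightarrow> 'a"
  assumes T: "firmly_nonexpansive T" and "0 \<le> k" and "k \<le> 1"
  shows "firmly_nonexpansive (\<lambda>x. (1 - k) *\<^sub>R x + k *\<^sub>R T x)"
  unfolding firmly_nonexpansive_def
proof (intro allI)
  fix x y :: 'a
  define d where "d = x - y"
  define e where "e = T x - T y"
  have diff: "(1 - k) *\<^sub>R x + k *\<^sub>R T x - ((1 - k) *\<^sub>R y + k *\<^sub>R T y) = (1 - k) *\<^sub>R d + k *\<^sub>R e"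
    by (simp add: d_def e_def algebra_simps)
  have "inner e e \<le> inner d e"
    using T unfolding firmly_nonexpansive_def d_def e_def power2_norm_eq_inner by blast
  moreover have "0 \<le> inner (d - e) (d - e)"
    by simp
  \<comment> \<open>This expression is exactly the slack in the inequality to be shown. It comes
    from expanding \<open>inner (d - w) w\<close> with
    \<open>w = (1 - k) *\<^sub>R d + k *\<^sub>R e\<close> and
    \<open>d - w = k *\<^sub>R (d - e)\<close>.\<close>
  ultimately have "0 \<le> k * (1 - k) * inner (d - e) (d - e) + k * (inner d e - inner e e)"
    using \<open>0 \<le> k\<close> \<open>k \<le> 1\<close> by (intro add_nonneg_nonneg mult_nonneg_nonneg) auto
  also have "\<dots> = inner d ((1 - k) *\<^sub>R d + k *\<^sub>R e) - (norm ((1 - k) *\<^sub>R d + k *\<^sub>R e))\<^sup>2"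
    by (simp add: power2_norm_eq_inner inner_simps inner_commute algebra_simps)
  finally show "(norm ((1 - k) *\<^sub>R x + k *\<^sub>R T x - ((1 - k) *\<^sub>R y + k *\<^sub>R T y)))\<^sup>2
      \<le> inner (x - y) ((1 - k) *\<^sub>R x + k *\<^sub>R T x - ((1 - k) *\<^sub>R y + k *\<^sub>R T y))"
    unfolding diff by (simp add: d_def)
qed

lemma nonexpansive_relaxation:
  fixes T :: "'a::real_normed_vector \<Rightarrow> 'a"
  assumes T: "nonexpansive T" and "0 \<le> k" and "k \<le> 1"
  shows "nonexpansive (\<lambda>x. (1 - k) *\<^sub>R x + k *\<^sub>R T x)"
  unfolding nonexpansive_def
proof (intro allI)
  fix x y :: 'a
  have "(1 - k) *\<^sub>R x + k *\<^sub>R T x - ((1 - k) *\<^sub>R y + k *\<^sub>R T y) =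
      (1 - k) *\<^sub>R (x - y) + k *\<^sub>R (T x - T y)"
    by (simp add: algebra_simps)
  then have "norm ((1 - k) *\<^sub>R x + k *\<^sub>R T x - ((1 - k) *\<^sub>R y + k *\<^sub>R T y)) \<le>
      (1 - k) * norm (x - y) + k * norm (T x - T y)"
    using norm_triangle_ineq[of "(1 - k) *\<^sub>R (x - y)" "k *\<^sub>R (T x - T y)"] assms(2,3) by simp
  also have "\<dots> \<le> (1 - k) * norm (x - y) + k * norm (x - y)"
    using T \<open>0 \<le> k\<close> unfolding nonexpansive_def by (intro add_left_mono mult_left_mono) auto
  finally show "norm ((1 - k) *\<^sub>R x + k *\<^sub>R T x - ((1 - k) *\<^sub>R y + k *\<^sub>R T y)) \<le> norm (x - y)"
    by (simp add: algebra_simps)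
qed

section \<open>Reduction of the four situations to similarities and relaxations\<close>

theorem proposition8p1:
  fixes f g :: "'a::{real_inner, complete_space} \<Rightarrow> real"
    and C :: "'a set"
    and s t :: "'a \<Rightarrow> 'a"
  assumes "convex_on UNIV f"
    and "continuous_on UNIV f"
    and "C = {x. f x \<le> 0}"
    and "C \<noteq> {}"
    and "\<forall>x \<in> UNIV - C. gateaux_differentiable_at f x"
    and "subgradient_selection f s"
    and "(\<exists>\<alpha>::real. \<alpha> > 0 \<and> g = f \<circ> (\<lambda>x. \<alpha> *\<^sub>R x) \<and> convex_on UNIV g)
       \<or> (\<exists>\<alpha>::real. (\<forall>x. f x \<ge> 0) \<and> \<alpha> \<ge> 1 \<and> g = (\<lambda>x. f x powr \<alpha>) \<and> convex_on UNIV g)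
       \<or> (\<exists>A::'a \<Rightarrow> 'a. bounded_linear A \<and> A \<circ> adjoint A = id \<and> adjoint A \<circ> A = id \<and> g = f \<circ> A)
       \<or> (\<exists>z::'a. g = (\<lambda>x. f (x - z)))"
    and "subgradient_selection g t"
  shows "(firmly_nonexpansive (subgradient_projector f s) \<longrightarrow>
            firmly_nonexpansive (subgradient_projector g t))
       \<and> (nonexpansive (subgradient_projector f s) \<longrightarrow>
            nonexpansive (subgradient_projector g t))"
proof -
  have gateaux: "gateaux_differentiable_at f x" if "0 < f x" for x
    using assms(3,5) that by auto
  have similarity: ?thesis
    if "g = f \<circ> P" "0 < c" "linear L" "surj P" "\<And>x y. P x - P y = L (x - y)"
      "\<And>x y. inner (L x) (L y) = c * inner x y" for c L and P :: "'a \<Rightarrow> 'a"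
  proof -
    have "P (subgradient_projector g t x) = subgradient_projector f s (P x)" for x
      using subgradient_projector_similarity[OF gateaux assms(6) _ that(2-6)] assms(8) that(1)
      by blast
    then show ?thesis
      using nonexpansive_similarity[OF that(2,5,6)] by blast
  qed
  from assms(7) show ?thesis
  proof (elim disjE exE conjE)
    fix \<alpha> :: real
    assume "\<alpha> > 0" and g: "g = f \<circ> (\<lambda>x. \<alpha> *\<^sub>R x)"
    show ?thesis
    \<comment> \<open>The scaling is its own linear part, with squared ratio
      \<open>\<alpha>\<^sup>2\<close>.\<close>
    proof (rule similarity[OF g])
      show "surj ((*\<^sub>R) \<alpha> :: 'a \<Rightarrow> 'a)"
        using \<open>\<alpha> > 0\<close> by (intro surjI[where f = "(*\<^sub>R) (inverse \<alpha>)"]) simp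
      show "0 < \<alpha>\<^sup>2"
        using \<open>\<alpha> > 0\<close> by simp
      show "linear ((*\<^sub>R) \<alpha> :: 'a \<Rightarrow> 'a)"
        by (rule linear_scaleR)
    qed (simp_all add: scaleR_diff_right power2_eq_square mult.assoc)
  next
    fix \<alpha> :: real
    assume nonneg: "\<forall>x. f x \<ge> 0" and "\<alpha> \<ge> 1" and g: "g = (\<lambda>x. f x powr \<alpha>)"
    have "subgradient_projector g t =
        (\<lambda>x. (1 - 1 / \<alpha>) *\<^sub>R x + (1 / \<alpha>) *\<^sub>R subgradient_projector f s x)"
      using subgradient_projector_powr[OF gateaux assms(6)] assms(8) nonneg \<open>\<alpha> \<ge> 1\<close>
      unfolding g by blast
    then show ?thesis
      using firmly_nonexpansive_relaxation[of "subgradient_projector f s" "1 / \<alpha>"]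
        nonexpansive_relaxation[of "subgradient_projector f s" "1 / \<alpha>"] \<open>\<alpha> \<ge> 1\<close>
      by simp
  next
    fix A :: "'a \<Rightarrow> 'a"
    assume "bounded_linear A" and "A \<circ> adjoint A = id" and "adjoint A \<circ> A = id"
      and g: "g = f \<circ> A"
    show ?thesis
    \<comment> \<open>The two adjoint identities play different parts:
      \<open>A \<circ> adjoint A = id\<close> makes \<open>A\<close> onto, and
      \<open>adjoint A \<circ> A = id\<close> makes it an isometry, so \<open>c\<close> is
      1.\<close>
    proof (rule similarity[OF g])
      show "linear A"
        using \<open>bounded_linear A\<close> by (rule bounded_linear.linear)
      then show "A x - A y = A (x - y)" for x y
        by (simp add: linear_diff)
      show "surj A"
        using \<open>A \<circ> adjoint A = id\<close> by (metis comp_apply id_apply surjI)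
      show "inner (A x) (A y) = 1 * inner x y" for x y
        using adjoint_works_Hilbert[OF \<open>bounded_linear A\<close>] \<open>adjoint A \<circ> A = id\<close>
        by (metis comp_apply id_apply mult_1)
    qed simp
  next
    fix z :: 'a
    assume "g = (\<lambda>x. f (x - z))"
    then have g: "g = f \<circ> (\<lambda>x. x - z)"
      by (simp add: comp_def)
    show ?thesis
    \<comment> \<open>A translation has the identity as its linear part, and \<open>c\<close> is
      1.\<close>
    proof (rule similarity[OF g])
      show "surj (\<lambda>x. x - z)"
        by (intro surjI[where f = "\<lambda>x. x + z"]) simp
      show "linear (\<lambda>x::'a. x)"
        by (rule linear_ident)
      show "inner x y = 1 * inner x y" for x y :: 'a
        by simp
    qed simp_all
  qed
qed

end
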